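(* Let $L>0$ be fixed, let $u_c>0$ be the positive solution of $u_cI_1(u_c)=2I_0(u_c)$, and for $0<u<u_c$ consider the spectral curve of planar Strebel graphs with uniform perimeter $L$ (with parameter $\mu=u^2/(L^2I_0(u))$), parametrized by $\zeta$: $$x=\frac{u}{L^2}\left(\zeta^2+u\right),\qquad y=\frac{\sqrt u}{L}\left(\zeta-\frac{u}{2I_0(u)}\sum_{k=1}^\infty\frac{I_k(u)}{(2k-1)!!}\,\zeta^{2k-1}\right).$$ Substitute $\zeta=-\sqrt{u_c-u}\;\xi$. Then, for fixed $\xi$, as $u\to u_c^-$ (equivalently $\mu\to\mu_c=\frac{u_c^2}{L^2I_0(u_c)}$ from below), $$x=\frac{u_c^2}{L^2}+(u_c-u)\,\frac{u_c}{L^2}\,(\xi^2-2)+O\big((u_c-u)^2\big),$$ $$y=(u_c-u)^{3/2}\,\frac{u_c^2-4}{6L\sqrt{u_c}}\,(\xi^3-3\xi)+O\big((u_c-u)^2\big).$$ Hence the rescaled limit (blow-up) of the spectral curve at its singularity is the spectral curve of the $(3,2)$ minimal model, $$\mathcal S_{(3,2)}:\qquad\tilde x(\xi)=\xi^2-2,\qquad\tilde y(\xi)=\xi^3-3\xi.$$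
   Context: $I_k(z)=\sum_{j\ge0}\frac{(z/2)^{2j+k}}{j!\,(j+k)!}$ is the modified Bessel function of the first kind, and $(2k-1)!!=1\cdot3\cdots(2k-1)$. The point $u_c$ is where $u\mapsto u^2/I_0(u)$ attains its maximum on $(0,\infty)$. The phrase "spectral curve of the $(3,2)$ minimal model" is just the name of the parametrized plane curve $\mathcal S_{(3,2)}$ displayed in the claim; the "rescaled limit" statement means that $\big(x-\tfrac{u_c^2}{L^2}\big)\big/\big((u_c-u)\tfrac{u_c}{L^2}\big)\to\tilde x(\xi)$ and $y\big/\big((u_c-u)^{3/2}\tfrac{u_c^2-4}{6L\sqrt{u_c}}\big)\to\tilde y(\xi)$. *)

theory Defs
  imports "HOL-Analysis.Analysis" "HOL-Library.Landau_Symbols"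
begin

definition bessel_I :: "nat \<Rightarrow> real \<Rightarrow> real" where
  "bessel_I k z = (\<Sum>j. (z / 2) ^ (2 * j + k) / (fact j * fact (j + k)))"

definition odd_double_fact :: "nat \<Rightarrow> nat" where
  "odd_double_fact k = (\<Prod>i = 1..k. 2 * i - 1)"

definition u_crit :: real where
  "u_crit = (THE u. 0 < u \<and> u * bessel_I 1 u = 2 * bessel_I 0 u)"

definition strebel_mu :: "real \<Rightarrow> real \<Rightarrow> real" where
  "strebel_mu L u = u\<^sup>2 / (L\<^sup>2 * bessel_I 0 u)"

definition strebel_x :: "real \<Rightarrow> real \<Rightarrow> complex \<Rightarrow> complex" where
  "strebel_x L u \<zeta> = of_real (u / L\<^sup>2) * (\<zeta>\<^sup>2 + of_real u)"

(* The sum over k \<ge> 1 is shifted: index j stands for k = Suc j. *)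
definition strebel_y :: "real \<Rightarrow> real \<Rightarrow> complex \<Rightarrow> complex" where
  "strebel_y L u \<zeta> = of_real (sqrt u / L) *
     (\<zeta> - of_real (u / (2 * bessel_I 0 u)) *
        (\<Sum>j. of_real (bessel_I (Suc j) u / real (odd_double_fact (Suc j)))
               * \<zeta> ^ (2 * Suc j - 1)))"

definition minimal_x_32 :: "complex \<Rightarrow> complex" where
  "minimal_x_32 \<xi> = \<xi>\<^sup>2 - 2"

definition minimal_y_32 :: "complex \<Rightarrow> complex" where
  "minimal_y_32 \<xi> = \<xi> ^ 3 - 3 * \<xi>"

(* The two series above converge everywhere, so the suminf's are genuine sums. *)

lemma bessel_I_term_bound:
  "norm ((z / 2) ^ (2 * j + k) / (fact j * fact (j + k)) :: real)
     \<le> \<bar>z / 2\<bar> ^ k / fact k * (((z / 2)\<^sup>2) ^ j / fact j)"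
proof -
  have "(fact k :: real) \<le> fact (j + k)" by (rule fact_mono) simp
  then have "\<bar>z / 2\<bar> ^ (2 * j + k) / (fact j * fact (j + k))
      \<le> \<bar>z / 2\<bar> ^ (2 * j + k) / (fact j * fact k)"
    by (intro divide_left_mono mult_left_mono) auto
  also have "\<dots> = \<bar>z / 2\<bar> ^ k / fact k * ((\<bar>z / 2\<bar>\<^sup>2) ^ j / fact j)"
    by (simp only: power_add power_mult) (simp add: mult.commute)
  finally show ?thesis
    by (simp only: power2_abs norm_divide norm_mult norm_power norm_fact) simp
qed

lemma exp_type_summable: "summable (\<lambda>j. a * (x ^ j / fact j) :: real)"
  using summable_exp[of x] by (intro summable_mult) (simp add: field_simps)

lemma summable_bessel_I:
  "summable (\<lambda>j. (z / 2) ^ (2 * j + k) / (fact j * fact (j + k)) :: real)"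
  by (rule summable_comparison_test'[OF exp_type_summable bessel_I_term_bound])

lemma abs_bessel_I_le: "\<bar>bessel_I k z\<bar> \<le> \<bar>z / 2\<bar> ^ k / fact k * exp ((z / 2)\<^sup>2)"
proof -
  have "norm (bessel_I k z) \<le> (\<Sum>j. \<bar>z / 2\<bar> ^ k / fact k * (((z / 2)\<^sup>2) ^ j / fact j))"
    unfolding bessel_I_def by (rule norm_suminf_le[OF bessel_I_term_bound exp_type_summable])
  also have "\<dots> = \<bar>z / 2\<bar> ^ k / fact k * (\<Sum>j. ((z / 2)\<^sup>2) ^ j / fact j)"
    using exp_type_summable[of 1] by (intro suminf_mult) simp
  also have "(\<Sum>j. ((z / 2)\<^sup>2) ^ j / fact j) = exp ((z / 2)\<^sup>2)"
    by (simp add: exp_def field_simps)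
  finally show ?thesis by simp
qed

lemma odd_double_fact_ge_1: "1 \<le> odd_double_fact k"
  unfolding odd_double_fact_def by (rule prod_ge_1) auto

lemma summable_strebel_y:
  "summable (\<lambda>j. of_real (bessel_I (Suc j) u / real (odd_double_fact (Suc j)))
               * (\<zeta> :: complex) ^ (2 * Suc j - 1))"
proof (rule summable_comparison_test')
  let ?C = "exp ((u / 2)\<^sup>2) * \<bar>u / 2\<bar> * norm \<zeta>"
  show "summable (\<lambda>j. ?C * ((\<bar>u / 2\<bar> * (norm \<zeta>)\<^sup>2) ^ j / fact j))"
    by (rule exp_type_summable)
  fix j :: nat
  have "\<bar>bessel_I (Suc j) u / real (odd_double_fact (Suc j))\<bar> \<le> \<bar>bessel_I (Suc j) u\<bar>"
    using odd_double_fact_ge_1[of "Suc j"] by (simp add: divide_le_eq mult_le_cancel_left1)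
  also have "\<dots> \<le> \<bar>u / 2\<bar> ^ Suc j / fact (Suc j) * exp ((u / 2)\<^sup>2)"
    by (rule abs_bessel_I_le)
  also have "\<dots> \<le> \<bar>u / 2\<bar> ^ Suc j / fact j * exp ((u / 2)\<^sup>2)"
    by (intro mult_right_mono divide_left_mono fact_mono) auto
  finally have "\<bar>bessel_I (Suc j) u / real (odd_double_fact (Suc j))\<bar> * norm \<zeta> ^ (2 * j + 1)
      \<le> \<bar>u / 2\<bar> ^ Suc j / fact j * exp ((u / 2)\<^sup>2) * norm \<zeta> ^ (2 * j + 1)"
    by (rule mult_right_mono) simp
  also have "\<dots> = ?C * ((\<bar>u / 2\<bar> * (norm \<zeta>)\<^sup>2) ^ j / fact j)"
    by (simp only: power_mult_distrib power_mult power_add power_Suc power_one_right) simp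
  finally show "norm (of_real (bessel_I (Suc j) u / real (odd_double_fact (Suc j)))
               * \<zeta> ^ (2 * Suc j - 1))
      \<le> ?C * ((\<bar>u / 2\<bar> * (norm \<zeta>)\<^sup>2) ^ j / fact j)"
    by (simp only: norm_mult norm_power norm_of_real) simp
qed

end

(*
  G(u) = u I_1(u) - 2 I_0(u) satisfies G'(u) = u I_2(u) > 0, hence has exactly one positive zero u_c,
  and (u^2 / I_0)' = - u G / I_0^2 makes u_c the strict maximum. In y the coefficient of zeta is
  -G / (2 I_0), which vanishes at u_c with slope -A, A = (u_c^2 - 4) / (2 u_c), while the coefficient
  of zeta^3 tends to -A / 3 because u_c^2 I_2(u_c) = (u_c^2 - 4) I_0(u_c). With zeta = - s xi and
  s = sqrt (u_c - u), both terms are therefore of order s^3, and all the rest of y is O(s^5).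
*)
theory Submission
  imports Defs
begin

text \<open>The 3 in xi^3 - 3 xi comes from G' = u I_2: at u_c the linear coefficient has slope -
  u_c I_2(u_c) / (2 I_0(u_c)), and the cubic coefficient is this same quantity divided by 3!! = 3.
  The identity for u_c^2 I_2(u_c) only puts the common factor into closed form. The pieces of y call
  for different precision. The linear coefficient is multiplied by zeta = O(s) alone, so it must be
  known up to O(s^4) = O((u_c - u)^2), a second-order Taylor estimate; for the cubic coefficient and
  the prefactor sqrt u / L first order suffices. The terms k >= 3 need a bound whose constant is
  uniform in u, because u and zeta move together. Derivatives are taken through the entire functions
  \<open>bessel_series k\<close> in the variable (z / 2)^2, where I_k(z) = (z / 2)^k
  \<open>bessel_series k ((z / 2)\<^sup>2)\<close>: differentiation raises k by one, and a
  three-term recurrence supplies the Bessel identities.\<close>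

section \<open>Bessel functions through entire power series\<close>

definition bessel_series :: "nat \<Rightarrow> real \<Rightarrow> real" where
  "bessel_series k s = (\<Sum>j. (1 / (fact j * fact (j + k))) * s ^ j)"

lemma summable_bessel_series: "summable (\<lambda>j. (1 / (fact j * fact (j + k))) * s ^ j :: real)"
proof (rule summable_comparison_test'[OF exp_type_summable[of 1 "\<bar>s\<bar>"]])
  fix j :: nat
  have "1 * fact j \<le> fact (j + k) * (fact j :: real)"
    by (intro mult_right_mono fact_ge_1) auto
  then have "1 / (fact j * fact (j + k)) * \<bar>s\<bar> ^ j \<le> 1 / fact j * \<bar>s\<bar> ^ j"
    by (intro mult_right_mono divide_left_mono) (auto simp: mult.commute)
  then show "norm ((1 / (fact j * fact (j + k))) * s ^ j) \<le> 1 * (\<bar>s\<bar> ^ j / fact j)"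
    by (simp add: abs_mult power_abs)
qed

lemma bessel_I_eq_series: "bessel_I k z = (z / 2) ^ k * bessel_series k ((z / 2)\<^sup>2)"
proof -
  have "(z / 2) ^ k * bessel_series k ((z / 2)\<^sup>2)
      = (\<Sum>j. (z / 2) ^ k * ((1 / (fact j * fact (j + k))) * ((z / 2)\<^sup>2) ^ j))"
    unfolding bessel_series_def by (rule suminf_mult[symmetric, OF summable_bessel_series])
  also have "\<dots> = bessel_I k z"
    unfolding bessel_I_def
    by (intro suminf_cong) (simp add: power_add flip: power_mult)
  finally show ?thesis by simp
qed

text \<open>Termwise differentiation: (j + 1) / ((j + 1)! (j + 1 + k)!) = 1 / (j! (j + k + 1)!),
  which is the coefficient for index k + 1.\<close>

lemma DERIV_bessel_series: "(bessel_series k has_real_derivative bessel_series (Suc k) s) (at s)"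
proof -
  let ?c = "\<lambda>j. 1 / (fact j * fact (j + k)) :: real"
  have "((\<lambda>x. \<Sum>n. ?c n * x ^ n) has_real_derivative (\<Sum>n. diffs ?c n * s ^ n)) (at s)"
    by (rule termdiffs_strong_converges_everywhere[OF summable_bessel_series])
  moreover have "diffs ?c = (\<lambda>j. 1 / (fact j * fact (j + Suc k)))"
    by (auto simp: diffs_def fun_eq_iff divide_simps)
  ultimately show ?thesis
    by (simp add: bessel_series_def[abs_def])
qed

text \<open>The coefficient for k is (j + k + 1) times the one for k + 1; splitting this factor as
  (k + 1) + j gives the two summands. In Bessel terms this is I_k - I_{k+2} = (2 (k + 1) / z)
  I_{k+1}.\<close>

lemma bessel_series_rec:
  "bessel_series k s = real (Suc k) * bessel_series (Suc k) s + s * bessel_series (Suc (Suc k)) s"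
proof -
  let ?c = "\<lambda>k j. 1 / (fact j * fact (j + k)) :: real"
  have A: "(\<lambda>j. real (Suc k) * (?c (Suc k) j * s ^ j)) sums (real (Suc k) * bessel_series (Suc k) s)"
    unfolding bessel_series_def by (intro sums_mult summable_sums summable_bessel_series)
  have "(\<lambda>j. s * (?c (Suc (Suc k)) j * s ^ j)) sums (s * bessel_series (Suc (Suc k)) s)"
    unfolding bessel_series_def by (intro sums_mult summable_sums summable_bessel_series)
  also have "(\<lambda>j. s * (?c (Suc (Suc k)) j * s ^ j)) =
      (\<lambda>j. real (Suc j) * ?c (Suc k) (Suc j) * s ^ Suc j)"
    by (auto simp: fun_eq_iff divide_simps)
  \<comment> \<open>The shift back to index j adds a term at j = 0, which vanishes because of the
    factor \<open>real j\<close>.\<close>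
  finally have B: "(\<lambda>j. real j * ?c (Suc k) j * s ^ j) sums (s * bessel_series (Suc (Suc k)) s)"
    by (subst (asm) sums_Suc_iff) simp
  have add_mult: "real (Suc k) * (c * p) + real j * c * p = real (Suc (j + k)) * c * p" for c p :: real and j
    by (simp add: algebra_simps)
  have "(\<lambda>j. real (Suc k) * (?c (Suc k) j * s ^ j) + real j * ?c (Suc k) j * s ^ j)
      = (\<lambda>j. ?c k j * s ^ j)"
  proof
    fix j
    have "real (Suc k) * (?c (Suc k) j * s ^ j) + real j * ?c (Suc k) j * s ^ j
        = real (Suc (j + k)) * ?c (Suc k) j * s ^ j"
      using add_mult[of "?c (Suc k) j" "s ^ j"] .
    also have "\<dots> = ?c k j * s ^ j" by (simp add: divide_simps)
    finally show "real (Suc k) * (?c (Suc k) j * s ^ j) + real j * ?c (Suc k) j * s ^ j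
      = ?c k j * s ^ j" .
  qed
  with sums_add[OF A B] have "(\<lambda>j. ?c k j * s ^ j) sums
      (real (Suc k) * bessel_series (Suc k) s + s * bessel_series (Suc (Suc k)) s)"
    by simp
  then show ?thesis unfolding bessel_series_def by (simp add: sums_iff)
qed

text \<open>The recurrence for k = 0, kept multiplied by u so that it also holds at u = 0 and
  matches the derivative of \<open>crit_fun\<close>.\<close>

lemma bessel_I_2_eq: "u * bessel_I 2 u = u * bessel_I 0 u - 2 * bessel_I 1 u"
  using bessel_series_rec[of 0 "(u / 2)\<^sup>2"]
  by (simp add: bessel_I_eq_series field_simps power2_eq_square numeral_2_eq_2)

lemma DERIV_bessel_I_0: "(bessel_I 0 has_real_derivative bessel_I 1 u) (at u)"
proof -
  have "((\<lambda>u. bessel_series 0 ((u / 2)\<^sup>2)) has_real_derivative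
      bessel_series (Suc 0) ((u / 2)\<^sup>2) * (u / 2)) (at u)"
    by (rule DERIV_chain2[OF DERIV_bessel_series]) (auto intro!: derivative_eq_intros)
  then show ?thesis
    by (simp add: bessel_I_eq_series[abs_def] mult.commute)
qed

text \<open>With t = (u / 2)^2 the function is 2 t \<open>bessel_series 1 t\<close>; the chain rule
  gives u (\<open>bessel_series 1 t\<close> + t \<open>bessel_series 2 t\<close>), and the
  recurrence for k = 0 turns the bracket into I_0.\<close>

lemma DERIV_mult_bessel_I_1:
  "((\<lambda>u. u * bessel_I 1 u) has_real_derivative u * bessel_I 0 u) (at u)"
proof -
  have "((\<lambda>u. 2 * ((u / 2)\<^sup>2 * bessel_series 1 ((u / 2)\<^sup>2))) has_real_derivative
      u * (bessel_series 1 ((u / 2)\<^sup>2) + (u / 2)\<^sup>2 * bessel_series 2 ((u / 2)\<^sup>2))) (at u)"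
    by (auto intro!: derivative_eq_intros DERIV_chain2[OF DERIV_bessel_series]
        simp: numeral_2_eq_2 algebra_simps)
  moreover have "(\<lambda>u. u * bessel_I 1 u) = (\<lambda>u. 2 * ((u / 2)\<^sup>2 * bessel_series 1 ((u / 2)\<^sup>2)))"
    by (auto simp: bessel_I_eq_series power2_eq_square)
  ultimately show ?thesis
    using bessel_series_rec[of 0 "(u / 2)\<^sup>2"] by (simp add: bessel_I_eq_series numeral_2_eq_2)
qed

section \<open>Positivity, the critical point and the maximum\<close>

lemma bessel_I_ge_first_term:
  assumes "0 \<le> u" shows "(u / 2) ^ k / fact k \<le> bessel_I k u"
  using sum_le_suminf[OF summable_bessel_I, of "{0}" u k] assms
  by (simp add: bessel_I_def)

text \<open>I_0 is even, so positivity holds for every real u, and quotients by I_0 can be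
  differentiated everywhere without a sign condition.\<close>

lemma bessel_I_0_pos: "0 < bessel_I 0 u"
proof -
  have "bessel_I 0 u = bessel_I 0 \<bar>u\<bar>" by (simp add: bessel_I_eq_series power_divide)
  with bessel_I_ge_first_term[of "\<bar>u\<bar>" 0] show ?thesis by simp
qed

lemma bessel_I_pos: "0 < u \<Longrightarrow> 0 < bessel_I k u"
  by (rule less_le_trans[OF _ bessel_I_ge_first_term]) auto

definition crit_fun :: "real \<Rightarrow> real" where
  "crit_fun u = u * bessel_I 1 u - 2 * bessel_I 0 u"

lemma DERIV_crit_fun: "(crit_fun has_real_derivative u * bessel_I 2 u) (at u)"
  unfolding crit_fun_def[abs_def] bessel_I_2_eq
  by (intro DERIV_diff DERIV_cmult DERIV_mult_bessel_I_1 DERIV_bessel_I_0)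

lemma crit_fun_less: assumes "0 \<le> a" "a < b" shows "crit_fun a < crit_fun b"
proof (rule DERIV_pos_imp_increasing_open[OF assms(2)])
  fix x assume "a < x" "x < b"
  then have "0 < x * bessel_I 2 x" using assms by (intro mult_pos_pos bessel_I_pos) auto
  then show "\<exists>y. DERIV crit_fun x :> y \<and> 0 < y" using DERIV_crit_fun by blast
next
  show "continuous_on {a..b} crit_fun"
    by (meson DERIV_crit_fun DERIV_isCont continuous_at_imp_continuous_on)
qed

text \<open>Upper bracket for the intermediate value theorem. The first term of I_2 gives G'(x) >=
  x^3 / 8, hence G(3) >= G(0) + 3^4 / 32 = -2 + 81 / 32 > 0.\<close>

lemma crit_fun_3_pos: "0 < crit_fun 3"
proof -
  have "crit_fun 0 - 0 ^ 4 / 32 \<le> crit_fun 3 - 3 ^ 4 / 32"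
  proof (rule DERIV_nonneg_imp_nondecreasing[of 0 3 "\<lambda>x. crit_fun x - x ^ 4 / 32"])
    fix x :: real assume x: "0 \<le> x"
    have "((\<lambda>x. crit_fun x - x ^ 4 / 32) has_real_derivative x * bessel_I 2 x - x ^ 3 / 8) (at x)"
      by (auto intro!: derivative_eq_intros DERIV_crit_fun)
    moreover have "x * ((x / 2)\<^sup>2 / fact 2) \<le> x * bessel_I 2 x"
      using x by (intro mult_left_mono bessel_I_ge_first_term)
    ultimately show "\<exists>y. DERIV (\<lambda>x. crit_fun x - x ^ 4 / 32) x :> y \<and> 0 \<le> y"
      by (intro exI conjI) (auto simp: power2_eq_square power3_eq_cube)
  qed simp
  moreover have "crit_fun 0 = -2"
    using powser_zero[of "\<lambda>j. 1 / (fact j * fact j) :: real"]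
    by (simp add: crit_fun_def bessel_I_eq_series bessel_series_def)
  ultimately show ?thesis by simp
qed

lemma ex1_critical: "\<exists>!u. 0 < u \<and> u * bessel_I 1 u = 2 * bessel_I 0 u"
proof -
  have "crit_fun 0 < 0"
    using bessel_I_0_pos[of 0] by (simp add: crit_fun_def)
  then obtain u where u: "0 \<le> u" "crit_fun u = 0"
    using IVT[of crit_fun 0 0 3] crit_fun_3_pos DERIV_isCont[OF DERIV_crit_fun]
    by (metis less_eq_real_def zero_le_numeral)
  with \<open>crit_fun 0 < 0\<close> have "0 < u" by (cases "u = 0") auto
  show ?thesis
  proof (rule ex1I[of _ u])
    show "0 < u \<and> u * bessel_I 1 u = 2 * bessel_I 0 u"
      using u \<open>0 < u\<close> by (simp add: crit_fun_def)
  next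
    fix v assume "0 < v \<and> v * bessel_I 1 v = 2 * bessel_I 0 v"
    then have "0 < v" "crit_fun v = 0" by (auto simp: crit_fun_def)
    then show "v = u"
      using u \<open>0 < u\<close> crit_fun_less[of u v] crit_fun_less[of v u] by linarith
  qed
qed

lemma u_crit_pos: "0 < u_crit" and u_crit_eq: "u_crit * bessel_I 1 u_crit = 2 * bessel_I 0 u_crit"
  using theI'[OF ex1_critical] by (simp_all add: u_crit_def)

lemma crit_fun_u_crit: "crit_fun u_crit = 0"
  using u_crit_eq by (simp add: crit_fun_def)

text \<open>Multiply \<open>bessel_I_2_eq\<close> by u_c and eliminate I_1 with the critical
  equation.\<close>

lemma u_crit_sq: "u_crit\<^sup>2 * bessel_I 2 u_crit = (u_crit\<^sup>2 - 4) * bessel_I 0 u_crit"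
  using arg_cong[OF bessel_I_2_eq[of u_crit], of "\<lambda>x. u_crit * x"] u_crit_eq
  by (simp add: algebra_simps power2_eq_square)

text \<open>Forced by positivity of I_2 and I_0 in \<open>u_crit_sq\<close>; it makes the scaling
  constant of y nonzero.\<close>

lemma u_crit_sq_gt_4: "4 < u_crit\<^sup>2"
proof -
  have "0 < u_crit\<^sup>2 * bessel_I 2 u_crit" using u_crit_pos by (simp add: bessel_I_pos)
  then show ?thesis unfolding u_crit_sq using bessel_I_0_pos[of u_crit] by (auto simp: zero_less_mult_iff)
qed

lemma DERIV_sq_div_bessel_I_0:
  "((\<lambda>u. u\<^sup>2 / bessel_I 0 u) has_real_derivative - u * crit_fun u / (bessel_I 0 u)\<^sup>2) (at u)"
  using bessel_I_0_pos[of u]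
  by (auto intro!: derivative_eq_intros DERIV_bessel_I_0
      simp: crit_fun_def power2_eq_square algebra_simps)

lemma continuous_sq_div_bessel_I_0: "isCont (\<lambda>u. u\<^sup>2 / bessel_I 0 u) u"
  by (rule DERIV_isCont[OF DERIV_sq_div_bessel_I_0])

lemma sq_div_bessel_I_0_less:
  assumes "0 < a" "a < b" "b \<le> u_crit"
  shows "a\<^sup>2 / bessel_I 0 a < b\<^sup>2 / bessel_I 0 b"
proof (rule DERIV_pos_imp_increasing_open[OF assms(2)])
  fix x assume x: "a < x" "x < b"
  then have "0 < - x * crit_fun x / (bessel_I 0 x)\<^sup>2"
    using crit_fun_less[of x u_crit] assms bessel_I_0_pos[of x]
    by (intro divide_pos_pos mult_neg_neg) (auto simp: crit_fun_u_crit)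
  then show "\<exists>y. DERIV (\<lambda>u. u\<^sup>2 / bessel_I 0 u) x :> y \<and> 0 < y"
    using DERIV_sq_div_bessel_I_0 by blast
qed (auto intro!: continuous_at_imp_continuous_on continuous_sq_div_bessel_I_0)

lemma sq_div_bessel_I_0_less_max:
  assumes "0 < u" "u \<noteq> u_crit"
  shows "u\<^sup>2 / bessel_I 0 u < u_crit\<^sup>2 / bessel_I 0 u_crit"
proof (cases "u < u_crit")
  case False
  with assms have less: "u_crit < u" by simp
  show ?thesis
  proof (rule DERIV_neg_imp_decreasing_open[OF less])
    fix x assume x: "u_crit < x" "x < u"
    then have "- x * crit_fun x / (bessel_I 0 x)\<^sup>2 < 0"
      using crit_fun_less[of u_crit x] u_crit_pos bessel_I_0_pos[of x]
      by (intro divide_neg_pos mult_neg_pos) (auto simp: crit_fun_u_crit)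
    then show "\<exists>y. DERIV (\<lambda>u. u\<^sup>2 / bessel_I 0 u) x :> y \<and> y < 0"
      using DERIV_sq_div_bessel_I_0 by blast
  qed (auto intro!: continuous_at_imp_continuous_on continuous_sq_div_bessel_I_0)
qed (use sq_div_bessel_I_0_less assms in auto)

section \<open>Equivalence of the limits in u and in mu\<close>

lemma strebel_mu_eq: "strebel_mu L u = (u\<^sup>2 / bessel_I 0 u) / L\<^sup>2"
  by (simp add: strebel_mu_def)

lemma strebel_mu_less_iff:
  "L > 0 \<Longrightarrow> strebel_mu L a < strebel_mu L b \<longleftrightarrow> a\<^sup>2 / bessel_I 0 a < b\<^sup>2 / bessel_I 0 b"
  unfolding strebel_mu_eq by (simp add: divide_less_cancel del: divide_divide_eq_left)

text \<open>An arbitrary filter covers every way of approaching the critical point. One direction is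
  continuity, with strict monotonicity keeping mu below its critical value; the other inverts mu by
  strict monotonicity.\<close>

lemma filterlim_strebel_mu_iff:
  assumes L: "L > 0" and F: "eventually (\<lambda>u. 0 < u \<and> u < u_crit) F"
  shows "filterlim (\<lambda>u. u) (at_left u_crit) F \<longleftrightarrow>
           filterlim (strebel_mu L) (at_left (strebel_mu L u_crit)) F"
proof
  assume lim: "filterlim (\<lambda>u. u) (at_left u_crit) F"
  have "isCont (strebel_mu L) u_crit"
    unfolding strebel_mu_eq[abs_def]
    by (intro isCont_divide continuous_sq_div_bessel_I_0 continuous_const) (use L in auto)
  with lim have "((\<lambda>u. strebel_mu L u) \<longlongrightarrow> strebel_mu L u_crit) F"
    by (auto simp: filterlim_at intro: isCont_tendsto_compose)
  moreover from F have "eventually (\<lambda>u. strebel_mu L u < strebel_mu L u_crit) F"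
    by eventually_elim
      (use L sq_div_bessel_I_0_less in \<open>auto simp: strebel_mu_less_iff\<close>)
  ultimately show "filterlim (strebel_mu L) (at_left (strebel_mu L u_crit)) F"
    by (auto simp: filterlim_at elim: eventually_mono)
next
  assume "filterlim (strebel_mu L) (at_left (strebel_mu L u_crit)) F"
  then have lim: "(strebel_mu L \<longlongrightarrow> strebel_mu L u_crit) F"
    by (simp add: filterlim_at)
  have "((\<lambda>u. u) \<longlongrightarrow> u_crit) F"
  proof (rule order_tendstoI)
    fix a assume a: "a < u_crit"
    \<comment> \<open>The bound a may be negative, while mu is known to increase only on (0, u_c];
      the maximum moves the comparison point into that interval.\<close>
    define b where "b = max a (u_crit / 2)"
    have b: "0 < b" "b < u_crit" "a \<le> b" using a u_crit_pos by (auto simp: b_def)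
    have "strebel_mu L b < strebel_mu L u_crit"
      using b L sq_div_bessel_I_0_less[of b u_crit]
      by (simp add: strebel_mu_less_iff)
    from order_tendstoD(1)[OF lim this] F show "eventually (\<lambda>u. a < u) F"
    proof eventually_elim
      case (elim u)
      have "\<not> u < b"
        using elim b L sq_div_bessel_I_0_less[of u b]
        by (auto simp flip: strebel_mu_less_iff[OF L])
      moreover have "u \<noteq> b" using elim by auto
      ultimately show ?case using b by simp
    qed
  next
    fix a assume "u_crit < a"
    from F show "eventually (\<lambda>u. u < a) F"
      by eventually_elim (use \<open>u_crit < a\<close> in auto)
  qed
  with F show "filterlim (\<lambda>u. u) (at_left u_crit) F"
    by (auto simp: filterlim_at elim: eventually_mono)
qed

section \<open>Taylor estimates and Landau classes at the critical point\<close>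

lemma bessel_I_DERIV_exists: "\<exists>D. (bessel_I k has_real_derivative D) (at u)"
  unfolding bessel_I_eq_series[abs_def]
  by (rule exI, (rule derivative_eq_intros DERIV_chain2[OF DERIV_bessel_series] refl | simp)+)

lemma bigo_at_DERIV:
  assumes "(f has_real_derivative D) (at c)"
  shows "(\<lambda>x. f x - f c) \<in> O[at c](\<lambda>x. x - c)"
  using assms
  by (intro bigoI_tendsto[of _ _ D])
    (auto simp: has_field_derivative_iff eventually_at_filter)

text \<open>Differentiability of f' at c alone gives |f' x - f' c| <= K |x - c| nearby; the mean
  value inequality for f x - f' c * x on the segment from c to x then yields the quadratic
  bound.\<close>

lemma bigo_at_DERIV2:
  assumes f: "\<And>x. (f has_real_derivative f' x) (at x)"
    and f': "(f' has_real_derivative D) (at c)"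
  shows "(\<lambda>x. f x - f c - f' c * (x - c)) \<in> O[at c](\<lambda>x. (x - c)\<^sup>2)"
proof -
  from bigo_at_DERIV[OF f'] obtain K where "K > 0"
    and "eventually (\<lambda>x. norm (f' x - f' c) \<le> K * norm (x - c)) (at c)"
    by (rule landau_o.bigE)
  then obtain d where d: "d > 0" "\<And>x. x \<noteq> c \<Longrightarrow> dist x c < d \<Longrightarrow> \<bar>f' x - f' c\<bar> \<le> K * \<bar>x - c\<bar>"
    by (auto simp: eventually_at)
  have "norm (f x - f c - f' c * (x - c)) \<le> K * norm ((x - c)\<^sup>2)" if x: "dist x c < d" for x
  proof -
    have "norm ((f x - f' c * x) - (f c - f' c * c)) \<le> K * \<bar>x - c\<bar> * norm (x - c)"
    proof (rule field_differentiable_bound[of "closed_segment c x" _ "\<lambda>z. f' z - f' c"])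
      fix z assume "z \<in> closed_segment c x"
      then have z: "\<bar>z - c\<bar> \<le> \<bar>x - c\<bar>"
        by (auto simp: closed_segment_eq_real_ivl split: if_splits)
      show "((\<lambda>x. f x - f' c * x) has_real_derivative f' z - f' c) (at z within closed_segment c x)"
        by (auto intro!: derivative_eq_intros DERIV_subset[OF f])
      have "\<bar>f' z - f' c\<bar> \<le> K * \<bar>z - c\<bar>"
        \<comment> \<open>The estimate comes from a punctured neighbourhood, so z = c is treated
          separately.\<close>
        using d(2)[of z] z x by (cases "z = c") (auto simp: dist_real_def)
      also have "\<dots> \<le> K * \<bar>x - c\<bar>" using z \<open>K > 0\<close> by simp
      finally show "norm (f' z - f' c) \<le> K * \<bar>x - c\<bar>" by simp
    qed auto
    moreover have "(f x - f' c * x) - (f c - f' c * c) = f x - f c - f' c * (x - c)"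
      by (simp add: algebra_simps)
    ultimately show ?thesis by (simp add: power2_eq_square abs_mult mult.assoc)
  qed
  then show ?thesis
    using \<open>d > 0\<close> by (intro bigoI[of _ K]) (auto simp: eventually_at)
qed

text \<open>All error terms are powers of \<open>sqrt (u_crit - u)\<close>; it is taken complex-valued so that
  Landau classes of complex functions multiply without coercions.\<close>

definition local_param :: "real \<Rightarrow> complex" where
  "local_param u = of_real (sqrt (u_crit - u))"

lemma local_param_sq: "u \<le> u_crit \<Longrightarrow> local_param u ^ 2 = of_real (u_crit - u)"
  unfolding local_param_def by (simp flip: of_real_power)

lemma local_param_nz: "u < u_crit \<Longrightarrow> local_param u \<noteq> 0"
  by (simp add: local_param_def)

lemma eventually_near_u_crit: "eventually (\<lambda>u. 0 < u \<and> u < u_crit) (at_left u_crit)"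
  using eventually_at_left_real[OF u_crit_pos] by eventually_elim auto

lemma local_param_tendsto_0: "(local_param \<longlongrightarrow> 0) (at_left u_crit)"
proof -
  have "isCont local_param u_crit"
    unfolding local_param_def[abs_def] by (intro continuous_intros)
  then have "(local_param \<longlongrightarrow> local_param u_crit) (at_left u_crit)"
    by (simp add: isCont_def filterlim_at_split)
  then show ?thesis by (simp add: local_param_def)
qed

text \<open>The quotient is the power n - m of a null function; its limit \<open>0 ^ (n - m)\<close>
  is 1 when m = n and 0 otherwise, so it is bounded in both cases.\<close>

lemma bigo_local_param_mono:
  assumes mn: "m \<le> n"
  shows "(\<lambda>u. local_param u ^ n) \<in> O[at_left u_crit](\<lambda>u. local_param u ^ m)"
proof -
  have "((\<lambda>u. local_param u ^ (n - m)) \<longlongrightarrow> 0 ^ (n - m)) (at_left u_crit)"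
    by (intro tendsto_power local_param_tendsto_0)
  moreover have "eventually (\<lambda>u. local_param u ^ (n - m) = local_param u ^ n / local_param u ^ m) (at_left u_crit)"
    using eventually_near_u_crit
    by eventually_elim (use mn in \<open>simp add: power_diff local_param_nz\<close>)
  ultimately have "((\<lambda>u. local_param u ^ n / local_param u ^ m) \<longlongrightarrow> 0 ^ (n - m)) (at_left u_crit)"
    by (rule Lim_transform_eventually)
  then show ?thesis
    by (rule bigoI_tendsto) (rule eventually_mono[OF eventually_near_u_crit], simp add: local_param_nz)
qed

text \<open>Carries a real two-sided estimate to the complex left-sided setting; the exponent
  doubles since |u - u_c| = |s|^2 there.\<close>

lemma bigo_of_real_local_param:
  assumes "f \<in> O[at u_crit](\<lambda>u. (u - u_crit) ^ n)"
  shows "(\<lambda>u. of_real (f u)) \<in> O[at_left u_crit](\<lambda>u. local_param u ^ (2 * n))"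
proof -
  have "f \<in> O[at_left u_crit](\<lambda>u. (u - u_crit) ^ n)"
    using assms by (rule landau_o.big.filter_mono[rotated]) (simp add: at_le)
  then have "(\<lambda>u. of_real (f u) :: complex) \<in> O[at_left u_crit](\<lambda>u. of_real ((u - u_crit) ^ n))"
    by (simp only: landau_o.big.of_real_iff)
  also have "(\<lambda>u. of_real ((u - u_crit) ^ n)) \<in> O[at_left u_crit](\<lambda>u. local_param u ^ (2 * n))"
    by (rule bigoI[of _ 1], use eventually_near_u_crit in eventually_elim)
      (simp add: power_mult local_param_sq norm_power abs_minus_commute flip: of_real_diff)
  finally show ?thesis .
qed

lemma bigo_one_isCont:
  fixes f :: "real \<Rightarrow> real"
  assumes "isCont f c"
  shows "(\<lambda>u. of_real (f u) :: complex) \<in> O[at_left c](\<lambda>_. 1)"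
proof (rule bigoI_tendsto)
  have "(f \<longlongrightarrow> f c) (at_left c)"
    using assms by (simp add: isCont_def filterlim_at_split)
  then show "((\<lambda>u. of_real (f u) / 1) \<longlongrightarrow> (of_real (f c) :: complex)) (at_left c)"
    by (simp add: tendsto_of_real)
qed simp

section \<open>Splitting y and bounding its tail\<close>

text \<open>Inside the bracket of y, this is the coefficient of zeta, and
  \<open>strebel_coeff3\<close> is minus that of zeta^3, with 6 = 2 * 3!!. In
  \<open>strebel_tail\<close> the index j stands for k = j + 3, and the factor u / (2 I_0) is left
  outside.\<close>

definition strebel_coeff1 :: "real \<Rightarrow> real" where
  "strebel_coeff1 u = 1 - u * bessel_I 1 u / (2 * bessel_I 0 u)"

definition strebel_coeff3 :: "real \<Rightarrow> real" where
  "strebel_coeff3 u = u * bessel_I 2 u / (6 * bessel_I 0 u)"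

definition strebel_tail :: "real \<Rightarrow> complex \<Rightarrow> complex" where
  "strebel_tail u \<zeta> = (\<Sum>j. of_real (bessel_I (j + 3) u / real (odd_double_fact (j + 3))) * \<zeta> ^ (2 * j + 5))"

lemma strebel_y_split:
  "strebel_y L u \<zeta> = of_real (sqrt u / L) *
     (of_real (strebel_coeff1 u) * \<zeta> - of_real (strebel_coeff3 u) * \<zeta> ^ 3
      - of_real (u / (2 * bessel_I 0 u)) * strebel_tail u \<zeta>)"
proof -
  let ?a = "\<lambda>j. of_real (bessel_I (Suc j) u / real (odd_double_fact (Suc j))) * \<zeta> ^ (2 * Suc j - 1)"
  have "(\<Sum>j. ?a j) = (\<Sum>j. ?a (j + 2)) + (\<Sum>j<2. ?a j)"
    by (rule suminf_split_initial_segment[OF summable_strebel_y])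
  also have "(\<Sum>j. ?a (j + 2)) = strebel_tail u \<zeta>"
    unfolding strebel_tail_def by (intro suminf_cong) (simp add: numeral_eq_Suc)
  also have "(\<Sum>j<2. ?a j) = of_real (bessel_I 1 u) * \<zeta> + of_real (bessel_I 2 u / 3) * \<zeta> ^ 3"
    by (simp add: numeral_2_eq_2 numeral_3_eq_3 odd_double_fact_def)
  finally have "strebel_y L u \<zeta> = of_real (sqrt u / L) * (\<zeta> - of_real (u / (2 * bessel_I 0 u)) *
      (strebel_tail u \<zeta> + (of_real (bessel_I 1 u) * \<zeta> + of_real (bessel_I 2 u / 3) * \<zeta> ^ 3)))"
    by (simp only: strebel_y_def)
  moreover have "strebel_coeff1 u = 1 - u / (2 * bessel_I 0 u) * bessel_I 1 u"
    "strebel_coeff3 u = u / (2 * bessel_I 0 u) * (bessel_I 2 u / 3)"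
    by (simp_all add: strebel_coeff1_def strebel_coeff3_def)
  ultimately show ?thesis
    by (simp only: of_real_diff of_real_mult of_real_1) (simp only: algebra_simps mult_1)
qed

text \<open>Bounding the double factorials below by 1 and (j + 3)! by j! leaves an exponential
  series in (u / 2) |zeta|^2. The bound is explicit in u and zeta so that both may vary.\<close>

lemma norm_strebel_tail_le:
  assumes "0 \<le> u"
  shows "norm (strebel_tail u \<zeta>)
    \<le> exp ((u / 2)\<^sup>2) * (u / 2) ^ 3 * exp (u / 2 * (norm \<zeta>)\<^sup>2) * norm \<zeta> ^ 5"
proof -
  let ?C = "exp ((u / 2)\<^sup>2) * (u / 2) ^ 3 * norm \<zeta> ^ 5"
  have "norm (strebel_tail u \<zeta>) \<le> (\<Sum>j. ?C * ((u / 2 * (norm \<zeta>)\<^sup>2) ^ j / fact j))"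
    unfolding strebel_tail_def
  proof (rule norm_suminf_le[OF _ exp_type_summable])
    fix j :: nat
    have "\<bar>bessel_I (j + 3) u / real (odd_double_fact (j + 3))\<bar> \<le> \<bar>bessel_I (j + 3) u\<bar>"
      using odd_double_fact_ge_1[of "j + 3"] by (simp add: divide_le_eq mult_le_cancel_left1)
    also have "\<dots> \<le> \<bar>u / 2\<bar> ^ (j + 3) / fact (j + 3) * exp ((u / 2)\<^sup>2)"
      by (rule abs_bessel_I_le)
    also have "\<dots> \<le> \<bar>u / 2\<bar> ^ (j + 3) / fact j * exp ((u / 2)\<^sup>2)"
      by (intro mult_right_mono divide_left_mono fact_mono) auto
    finally have "\<bar>bessel_I (j + 3) u / real (odd_double_fact (j + 3))\<bar> * norm \<zeta> ^ (2 * j + 5)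
        \<le> \<bar>u / 2\<bar> ^ (j + 3) / fact j * exp ((u / 2)\<^sup>2) * norm \<zeta> ^ (2 * j + 5)"
      by (rule mult_right_mono) simp
    also have "\<dots> = ?C * ((u / 2 * (norm \<zeta>)\<^sup>2) ^ j / fact j)"
      using assms
      by (simp only: power_mult_distrib power_mult power_add abs_of_nonneg) simp
    finally show "norm (of_real (bessel_I (j + 3) u / real (odd_double_fact (j + 3))) * \<zeta> ^ (2 * j + 5))
        \<le> ?C * ((u / 2 * (norm \<zeta>)\<^sup>2) ^ j / fact j)"
      by (simp only: norm_mult norm_power norm_of_real)
  qed
  also have "\<dots> = ?C * (\<Sum>j. (u / 2 * (norm \<zeta>)\<^sup>2) ^ j / fact j)"
    using exp_type_summable[of 1] by (intro suminf_mult) simp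
  also have "(\<Sum>j. (u / 2 * (norm \<zeta>)\<^sup>2) ^ j / fact j) = exp (u / 2 * (norm \<zeta>)\<^sup>2)"
    by (simp add: exp_def field_simps)
  finally show ?thesis by (simp add: mult_ac)
qed

text \<open>For 0 < u < u_c the factors of the explicit bound are at most their values with u
  replaced by u_c, and |zeta|^2 <= u_c |xi|^2; only |zeta|^5 is kept, supplying s^5.\<close>

lemma bigo_strebel_tail:
  "(\<lambda>u. strebel_tail u (- local_param u * \<xi>)) \<in> O[at_left u_crit](\<lambda>u. local_param u ^ 5)"
proof (rule bigoI, use eventually_near_u_crit in eventually_elim)
  let ?r = "u_crit / 2 * (u_crit * (norm \<xi>)\<^sup>2)"
  fix u assume u: "0 < u \<and> u < u_crit"
  have "(norm (- local_param u * \<xi>))\<^sup>2 = (u_crit - u) * (norm \<xi>)\<^sup>2"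
    using u by (simp add: norm_mult power_mult_distrib local_param_def)
  also have "\<dots> \<le> u_crit * (norm \<xi>)\<^sup>2"
    using u by (intro mult_right_mono) auto
  finally have n: "(norm (- local_param u * \<xi>))\<^sup>2 \<le> u_crit * (norm \<xi>)\<^sup>2" .
  have "norm (strebel_tail u (- local_param u * \<xi>)) \<le> exp ((u / 2)\<^sup>2) * (u / 2) ^ 3 *
      exp (u / 2 * (norm (- local_param u * \<xi>))\<^sup>2) * norm (- local_param u * \<xi>) ^ 5"
    using u by (intro norm_strebel_tail_le) auto
  also have "\<dots> \<le> exp ((u_crit / 2)\<^sup>2) * (u_crit / 2) ^ 3 * exp ?r * norm (- local_param u * \<xi>) ^ 5"
    using u n by (intro mult_mono power_mono exp_le_cancel_iff[THEN iffD2]) auto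
  also have "\<dots> = (exp ((u_crit / 2)\<^sup>2) * (u_crit / 2) ^ 3 * exp ?r * norm \<xi> ^ 5) * norm (local_param u ^ 5)"
    by (simp add: norm_mult norm_power power_mult_distrib)
  finally show "norm (strebel_tail u (- local_param u * \<xi>))
    \<le> (exp ((u_crit / 2)\<^sup>2) * (u_crit / 2) ^ 3 * exp ?r * norm \<xi> ^ 5) * norm (local_param u ^ 5)" .
qed

section \<open>Expansion of the linear and cubic coefficients\<close>

abbreviation crit_slope :: real where
  "crit_slope \<equiv> (u_crit\<^sup>2 - 4) / (2 * u_crit)"

lemma strebel_coeff1_eq: "strebel_coeff1 u = - crit_fun u / (2 * bessel_I 0 u)"
  using bessel_I_0_pos[of u] by (simp add: strebel_coeff1_def crit_fun_def field_simps)

lemma strebel_coeff1_u_crit: "strebel_coeff1 u_crit = 0"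
  by (simp add: strebel_coeff1_eq crit_fun_u_crit)

lemma strebel_coeff3_u_crit: "strebel_coeff3 u_crit = crit_slope / 3"
  using u_crit_sq bessel_I_0_pos[of u_crit] u_crit_pos
  by (simp add: strebel_coeff3_def field_simps power2_eq_square)

text \<open>The quotient rule for -G / (2 I_0) with G' = u I_2 and I_0' = I_1; at u_c the summand
  with G drops out.\<close>

definition strebel_coeff1_deriv :: "real \<Rightarrow> real" where
  "strebel_coeff1_deriv u =
     (crit_fun u * bessel_I 1 u - u * bessel_I 2 u * bessel_I 0 u) / (2 * (bessel_I 0 u)\<^sup>2)"

lemma DERIV_strebel_coeff1: "(strebel_coeff1 has_real_derivative strebel_coeff1_deriv u) (at u)"
  unfolding strebel_coeff1_eq[abs_def] strebel_coeff1_deriv_def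
  using bessel_I_0_pos[of u]
  by (auto intro!: derivative_eq_intros DERIV_crit_fun DERIV_bessel_I_0
      simp: field_simps power2_eq_square)

lemma strebel_coeff1_deriv_u_crit: "strebel_coeff1_deriv u_crit = - crit_slope"
  using u_crit_sq bessel_I_0_pos[of u_crit] u_crit_pos
  by (simp add: strebel_coeff1_deriv_def crit_fun_u_crit field_simps power2_eq_square)

lemma strebel_coeff1_deriv_DERIV_exists:
  "\<exists>D. (strebel_coeff1_deriv has_real_derivative D) (at u)"
proof -
  obtain D1 D2 where "(bessel_I 1 has_real_derivative D1) (at u)"
    "(bessel_I 2 has_real_derivative D2) (at u)"
    using bessel_I_DERIV_exists by metis
  note [derivative_intros] = this DERIV_crit_fun DERIV_bessel_I_0
  show ?thesis
    unfolding strebel_coeff1_deriv_def[abs_def]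
    using bessel_I_0_pos[of u]
    by (intro exI) (rule derivative_intros | simp)+
qed

lemma strebel_coeff3_DERIV_exists: "\<exists>D. (strebel_coeff3 has_real_derivative D) (at u)"
proof -
  obtain D2 where "(bessel_I 2 has_real_derivative D2) (at u)"
    using bessel_I_DERIV_exists by metis
  note [derivative_intros] = this DERIV_bessel_I_0
  show ?thesis
    unfolding strebel_coeff3_def[abs_def]
    using bessel_I_0_pos[of u]
    by (intro exI) (rule derivative_intros | simp)+
qed

section \<open>Error terms of y and x\<close>

text \<open>Freezing a factor at its leading behaviour costs s^5 each time: prefactor s^2 * s^3,
  linear coefficient s^4 * s, cubic coefficient s^2 * s^3; the tail is s^5 by itself.\<close>

lemma bigo_strebel_y_error:
  "(\<lambda>u. strebel_y L u (- local_param u * \<xi>)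
      - local_param u ^ 3 * of_real ((u_crit\<^sup>2 - 4) / (6 * L * sqrt u_crit)) * (\<xi> ^ 3 - 3 * \<xi>))
    \<in> O[at_left u_crit](\<lambda>u. local_param u ^ 5)" (is "?E \<in> _")
proof -
  let ?S = local_param and ?F = "at_left u_crit"
  let ?z = "\<lambda>u. - ?S u * \<xi>"
  let ?a = "\<lambda>u. of_real (strebel_coeff1 u) :: complex"
  let ?b = "\<lambda>u. of_real (strebel_coeff3 u) :: complex"
  let ?q = "\<lambda>u. of_real (sqrt u / L) :: complex"
  let ?p = "\<lambda>u. of_real (u / (2 * bessel_I 0 u)) :: complex"
  let ?R = "\<lambda>u. strebel_tail u (?z u)"
  let ?A = "of_real crit_slope :: complex"

  have z: "?z \<in> O[?F](\<lambda>u. ?S u)"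
    by (rule bigoI[of _ "norm \<xi>"]) (simp add: norm_mult)
  have z3: "(\<lambda>u. ?z u ^ 3) \<in> O[?F](\<lambda>u. ?S u ^ 3)"
    by (rule landau_o.big_power[OF z])

  have sqrt_deriv: "((\<lambda>u. sqrt u / L) has_real_derivative (inverse (sqrt u_crit) / 2) / L) (at u_crit)"
    by (rule DERIV_cdivide[OF DERIV_real_sqrt[OF u_crit_pos]])
  have "(\<lambda>u. of_real (sqrt u / L - sqrt u_crit / L)) \<in> O[?F](\<lambda>u. ?S u ^ (2 * 1))"
    using bigo_at_DERIV[OF sqrt_deriv] by (intro bigo_of_real_local_param) simp
  then have q: "(\<lambda>u. ?q u - ?q u_crit) \<in> O[?F](\<lambda>u. ?S u ^ 2)"
    by simp
  have q1: "?q \<in> O[?F](\<lambda>_. 1)"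
    by (rule bigo_one_isCont[OF DERIV_isCont[OF sqrt_deriv]])

  have "(\<lambda>u. of_real (strebel_coeff1 u - strebel_coeff1 u_crit)) \<in> O[?F](\<lambda>u. ?S u ^ (2 * 1))"
    using bigo_at_DERIV[OF DERIV_strebel_coeff1] by (intro bigo_of_real_local_param) simp
  then have a: "?a \<in> O[?F](\<lambda>u. ?S u ^ 2)"
    by (simp add: strebel_coeff1_u_crit)

  \<comment> \<open>Flips u - u_c into u_c - u, the form in which it equals the square of
    \<open>local_param u\<close>.\<close>
  have lin: "of_real (a + A * (u - c)) = of_real a - of_real A * (of_real (c - u) :: complex)" for a A u c
    by (simp add: algebra_simps)
  obtain D where "(strebel_coeff1_deriv has_real_derivative D) (at u_crit)"
    using strebel_coeff1_deriv_DERIV_exists by blast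
  from bigo_of_real_local_param[OF bigo_at_DERIV2[OF DERIV_strebel_coeff1 this]]
  have "(\<lambda>u. of_real (strebel_coeff1 u + crit_slope * (u - u_crit))) \<in> O[?F](\<lambda>u. ?S u ^ 4)"
    by (simp add: strebel_coeff1_u_crit strebel_coeff1_deriv_u_crit del: of_real_add of_real_diff of_real_mult)
  also have "?this \<longleftrightarrow> (\<lambda>u. ?a u - ?A * ?S u ^ 2) \<in> O[?F](\<lambda>u. ?S u ^ 4)"
    by (rule landau_o.big.in_cong, rule eventually_mono[OF eventually_near_u_crit])
      (simp only: local_param_sq less_imp_le lin)
  finally have a2: "(\<lambda>u. ?a u - ?A * ?S u ^ 2) \<in> O[?F](\<lambda>u. ?S u ^ 4)" .

  obtain D' where D': "(strebel_coeff3 has_real_derivative D') (at u_crit)"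
    using strebel_coeff3_DERIV_exists by blast
  have "(\<lambda>u. of_real (strebel_coeff3 u - strebel_coeff3 u_crit)) \<in> O[?F](\<lambda>u. ?S u ^ (2 * 1))"
    using bigo_at_DERIV[OF D'] by (intro bigo_of_real_local_param) simp
  then have b: "(\<lambda>u. ?b u - ?A / 3) \<in> O[?F](\<lambda>u. ?S u ^ 2)"
    by (simp add: strebel_coeff3_u_crit)
  have b1: "?b \<in> O[?F](\<lambda>_. 1)"
    by (rule bigo_one_isCont[OF DERIV_isCont[OF D']])

  have p: "?p \<in> O[?F](\<lambda>_. 1)"
    using bessel_I_0_pos[of u_crit]
    by (intro bigo_one_isCont continuous_intros DERIV_isCont[OF DERIV_bessel_I_0]) auto

  note R = bigo_strebel_tail[of \<xi>]

  \<comment> \<open>The two terms reach s^3 differently: s^2 * s for the linear one, 1 * s^3 for the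
    cubic one.\<close>
  have "(\<lambda>u. ?a u * ?z u - ?b u * ?z u ^ 3) \<in> O[?F](\<lambda>u. ?S u ^ 3)"
    using landau_o.big.mult[OF a z] landau_o.big.mult[OF b1 z3]
    by (intro sum_in_bigo) (simp_all flip: power_Suc2)
  from landau_o.big.mult[OF q this]
  have E1: "(\<lambda>u. (?q u - ?q u_crit) * (?a u * ?z u - ?b u * ?z u ^ 3)) \<in> O[?F](\<lambda>u. ?S u ^ 5)"
    by (simp flip: power_add)
  have "(\<lambda>u. (?a u - ?A * ?S u ^ 2) * ?z u - (?b u - ?A / 3) * ?z u ^ 3) \<in> O[?F](\<lambda>u. ?S u ^ 5)"
    using landau_o.big.mult[OF a2 z] landau_o.big.mult[OF b z3]
    by (intro sum_in_bigo) (simp_all flip: power_add power_Suc2)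
  then have E2: "(\<lambda>u. ?q u_crit * ((?a u - ?A * ?S u ^ 2) * ?z u - (?b u - ?A / 3) * ?z u ^ 3)) \<in> O[?F](\<lambda>u. ?S u ^ 5)"
    using landau_o.big.mult[OF bigo_const[of "?q u_crit"]] by fastforce
  from landau_o.big.mult[OF q1 landau_o.big.mult[OF p R]]
  have E3: "(\<lambda>u. ?q u * (?p u * ?R u)) \<in> O[?F](\<lambda>u. ?S u ^ 5)" by simp

  have "(u_crit\<^sup>2 - 4) / (6 * L * sqrt u_crit) = sqrt u_crit / L * (crit_slope / 3)"
  proof -
    \<comment> \<open>Here r stands for sqrt u_c and r * r for u_c, so the simplifier faces a
      rational identity free of roots.\<close>
    have "e / (6 * L * r) = r / L * (e / (2 * (r * r)) / 3)" if "r \<noteq> 0" for e r :: real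
      using that by (simp add: field_simps)
    from this[of "sqrt u_crit" "u_crit\<^sup>2 - 4"] show ?thesis
      using u_crit_pos by simp
  qed
  then have A: "of_real ((u_crit\<^sup>2 - 4) / (6 * L * sqrt u_crit)) = ?q u_crit * (?A / 3)"
    by (simp only: of_real_mult of_real_divide of_real_numeral)
  have "?E u = (?q u - ?q u_crit) * (?a u * ?z u - ?b u * ?z u ^ 3)
      + ?q u_crit * ((?a u - ?A * ?S u ^ 2) * ?z u - (?b u - ?A / 3) * ?z u ^ 3)
      - ?q u * (?p u * ?R u)" for u
  proof -
    \<comment> \<open>Telescoping over independent symbols: q X - q0 X0 = (q - q0) X + q0 (X - X0),
      where X0 has the coefficients A s^2 and A / 3.\<close>
    have ring: "q * (a * (- s * x) - b * (- s * x) ^ 3 - p * r) - s ^ 3 * (q0 * (A / 3)) * (x ^ 3 - 3 * x)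
      = (q - q0) * (a * (- s * x) - b * (- s * x) ^ 3)
      + q0 * ((a - A * s ^ 2) * (- s * x) - (b - A / 3) * (- s * x) ^ 3) - q * (p * r)"
      for q q0 a b p r s x A :: complex
      by (simp add: field_simps power2_eq_square power3_eq_cube)
    show ?thesis unfolding strebel_y_split A by (rule ring)
  qed
  with E1 E2 E3 show ?thesis
    by (simp only: sum_in_bigo)
qed

text \<open>After the substitution x is a quadratic polynomial in t = u_c - u, so the remainder is
  exactly its t^2 term.\<close>

lemma strebel_x_error:
  assumes "u < u_crit" "L \<noteq> 0"
  shows "strebel_x L u (- local_param u * \<xi>) - (of_real (u_crit\<^sup>2 / L\<^sup>2)
      + of_real ((u_crit - u) * (u_crit / L\<^sup>2)) * (\<xi>\<^sup>2 - 2))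
    = of_real ((u_crit - u)\<^sup>2) * ((1 - \<xi>\<^sup>2) / of_real (L\<^sup>2))"
proof -
  have "(- local_param u * \<xi>)\<^sup>2 = of_real (u_crit - u) * \<xi>\<^sup>2"
    using assms by (simp only: power_mult_distrib power2_minus local_param_sq less_imp_le)
  then have "strebel_x L u (- local_param u * \<xi>) = of_real (u / L\<^sup>2) * (of_real (u_crit - u) * \<xi>\<^sup>2 + of_real u)"
    by (simp only: strebel_x_def)
  then show ?thesis
    using assms
    by (simp add: divide_simps) (simp add: algebra_simps power2_eq_square)
qed

theorem mainTheorem6:
  fixes L :: real
  assumes "L > 0"
  shows
    "(\<exists>!u. 0 < u \<and> u * bessel_I 1 u = 2 * bessel_I 0 u)
     \<and> (\<forall>u>0. u \<noteq> u_crit \<longrightarrow> u\<^sup>2 / bessel_I 0 u < u_crit\<^sup>2 / bessel_I 0 u_crit)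
     \<and> (\<forall>F :: real filter. eventually (\<lambda>u. 0 < u \<and> u < u_crit) F \<longrightarrow>
          (filterlim (\<lambda>u. u) (at_left u_crit) F \<longleftrightarrow>
           filterlim (strebel_mu L) (at_left (strebel_mu L u_crit)) F))
     \<and> (\<forall>\<xi> :: complex.
          (\<lambda>u. strebel_x L u (- of_real (sqrt (u_crit - u)) * \<xi>)
               - (of_real (u_crit\<^sup>2 / L\<^sup>2)
                  + of_real ((u_crit - u) * (u_crit / L\<^sup>2)) * (\<xi>\<^sup>2 - 2)))
            \<in> O[at_left u_crit](\<lambda>u. of_real ((u_crit - u)\<^sup>2))
        \<and> (\<lambda>u. strebel_y L u (- of_real (sqrt (u_crit - u)) * \<xi>)
               - of_real ((u_crit - u) powr (3 / 2)
                          * ((u_crit\<^sup>2 - 4) / (6 * L * sqrt u_crit))) * (\<xi> ^ 3 - 3 * \<xi>))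
            \<in> O[at_left u_crit](\<lambda>u. of_real ((u_crit - u)\<^sup>2))
        \<and> ((\<lambda>u. (strebel_x L u (- of_real (sqrt (u_crit - u)) * \<xi>) - of_real (u_crit\<^sup>2 / L\<^sup>2))
                 / of_real ((u_crit - u) * (u_crit / L\<^sup>2)))
            \<longlongrightarrow> minimal_x_32 \<xi>) (at_left u_crit)
        \<and> ((\<lambda>u. strebel_y L u (- of_real (sqrt (u_crit - u)) * \<xi>)
                 / of_real ((u_crit - u) powr (3 / 2)
                            * ((u_crit\<^sup>2 - 4) / (6 * L * sqrt u_crit))))
            \<longlongrightarrow> minimal_y_32 \<xi>) (at_left u_crit))"
proof (intro conjI allI impI)
  show "\<exists>!u. 0 < u \<and> u * bessel_I 1 u = 2 * bessel_I 0 u" by (rule ex1_critical)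
  show "u\<^sup>2 / bessel_I 0 u < u_crit\<^sup>2 / bessel_I 0 u_crit" if "u > 0" "u \<noteq> u_crit" for u
    using that by (rule sq_div_bessel_I_0_less_max)
  show "filterlim (\<lambda>u. u) (at_left u_crit) F \<longleftrightarrow>
      filterlim (strebel_mu L) (at_left (strebel_mu L u_crit)) F"
    if "eventually (\<lambda>u. 0 < u \<and> u < u_crit) F" for F :: "real filter"
    using assms that by (rule filterlim_strebel_mu_iff)
next
  fix \<xi> :: complex
  let ?F = "at_left u_crit" and ?c = "(u_crit\<^sup>2 - 4) / (6 * L * sqrt u_crit)"
  let ?x = "\<lambda>u. strebel_x L u (- of_real (sqrt (u_crit - u)) * \<xi>)"
  let ?y = "\<lambda>u. strebel_y L u (- of_real (sqrt (u_crit - u)) * \<xi>)"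
  let ?ymain = "\<lambda>u. of_real ((u_crit - u) powr (3 / 2) * ?c) * (\<xi> ^ 3 - 3 * \<xi>)"
  have x_err: "?x u - (of_real (u_crit\<^sup>2 / L\<^sup>2) + of_real ((u_crit - u) * (u_crit / L\<^sup>2)) * (\<xi>\<^sup>2 - 2))
      = of_real ((u_crit - u)\<^sup>2) * ((1 - \<xi>\<^sup>2) / of_real (L\<^sup>2))" if "u < u_crit" for u
    using strebel_x_error[of u L \<xi>] that assms by (simp add: local_param_def)
  show "(\<lambda>u. ?x u - (of_real (u_crit\<^sup>2 / L\<^sup>2) + of_real ((u_crit - u) * (u_crit / L\<^sup>2)) * (\<xi>\<^sup>2 - 2)))
      \<in> O[?F](\<lambda>u. of_real ((u_crit - u)\<^sup>2))"
  proof (rule bigoI, use eventually_near_u_crit in eventually_elim)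
    fix u assume "0 < u \<and> u < u_crit"
    then show "norm (?x u - (of_real (u_crit\<^sup>2 / L\<^sup>2) + of_real ((u_crit - u) * (u_crit / L\<^sup>2)) * (\<xi>\<^sup>2 - 2)))
        \<le> norm ((1 - \<xi>\<^sup>2) / of_real (L\<^sup>2)) * norm (of_real ((u_crit - u)\<^sup>2) :: complex)"
      by (subst x_err) (simp_all only: norm_mult mult.commute)
  qed

  \<comment> \<open>Positivity of u_c - u turns the real power 3/2 into the cube of the square
    root.\<close>
  have powr: "of_real ((u_crit - u) powr (3 / 2)) = local_param u ^ 3" if "u < u_crit" for u
  proof -
    have "(u_crit - u) powr (3 / 2) = ((u_crit - u) powr (1 / 2)) powr real 3"
      by (simp add: powr_powr)
    also have "\<dots> = sqrt (u_crit - u) ^ 3"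
      using that by (simp only: powr_half_sqrt less_imp_le diff_ge_0_iff_ge powr_realpow real_sqrt_gt_zero diff_gt_0_iff_gt)
    finally show ?thesis by (simp add: local_param_def)
  qed
  have "(\<lambda>u. ?y u - ?ymain u) \<in> O[?F](\<lambda>u. local_param u ^ 5) \<longleftrightarrow>
      (\<lambda>u. strebel_y L u (- local_param u * \<xi>) - local_param u ^ 3 * of_real ?c * (\<xi> ^ 3 - 3 * \<xi>))
        \<in> O[?F](\<lambda>u. local_param u ^ 5)"
    by (rule landau_o.big.in_cong, rule eventually_mono[OF eventually_near_u_crit])
      (simp only: of_real_mult powr local_param_def)
  then have y_err: "(\<lambda>u. ?y u - ?ymain u) \<in> O[?F](\<lambda>u. local_param u ^ 5)"
    using bigo_strebel_y_error by simp
  \<comment> \<open>The claimed error (u_c - u)^2 is s^4, one power of s weaker than what was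
    obtained.\<close>
  also have "(\<lambda>u. local_param u ^ 5) \<in> O[?F](\<lambda>u. local_param u ^ 4)"
    by (rule bigo_local_param_mono) simp
  also have "(\<lambda>u. local_param u ^ 4) \<in> O[?F](\<lambda>u. of_real ((u_crit - u)\<^sup>2))"
  proof (intro bigoI[of _ 1] eventually_mono[OF eventually_near_u_crit])
    fix u assume u: "0 < u \<and> u < u_crit"
    have "local_param u ^ 4 = (local_param u ^ 2) ^ 2" by simp
    also have "\<dots> = of_real ((u_crit - u)\<^sup>2)"
      using u by (simp only: local_param_sq less_imp_le of_real_power)
    finally show "norm (local_param u ^ 4) \<le> 1 * norm (of_real ((u_crit - u)\<^sup>2) :: complex)" by simp
  qed
  finally show "(\<lambda>u. ?y u - ?ymain u) \<in> O[?F](\<lambda>u. of_real ((u_crit - u)\<^sup>2))" .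

  \<comment> \<open>This is the rescaled x in exact form: the remainder t^2 (1 - xi^2) / L^2 divided
    by t u_c / L^2.\<close>
  have "((\<lambda>u. (\<xi>\<^sup>2 - 2) + of_real (u_crit - u) * ((1 - \<xi>\<^sup>2) / of_real u_crit)) \<longlongrightarrow>
      (\<xi>\<^sup>2 - 2) + of_real (u_crit - u_crit) * ((1 - \<xi>\<^sup>2) / of_real u_crit)) ?F"
    by (intro tendsto_intros)
  then have "((\<lambda>u. (\<xi>\<^sup>2 - 2) + of_real (u_crit - u) * ((1 - \<xi>\<^sup>2) / of_real u_crit)) \<longlongrightarrow> minimal_x_32 \<xi>) ?F"
    by (simp add: minimal_x_32_def)
  then show "((\<lambda>u. (?x u - of_real (u_crit\<^sup>2 / L\<^sup>2)) / of_real ((u_crit - u) * (u_crit / L\<^sup>2)))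
      \<longlongrightarrow> minimal_x_32 \<xi>) ?F"
  proof (rule Lim_transform_eventually, use eventually_near_u_crit in eventually_elim)
    fix u assume u: "0 < u \<and> u < u_crit"
    have ring: "(\<xi>\<^sup>2 - 2) + t * ((1 - \<xi>\<^sup>2) / c)
        = (t * (c / l) * (\<xi>\<^sup>2 - 2) + t\<^sup>2 * ((1 - \<xi>\<^sup>2) / l)) / (t * (c / l))"
      if "t \<noteq> 0" "c \<noteq> 0" "l \<noteq> 0" for t c l :: complex
      using that by (simp add: field_simps power2_eq_square)
    have "?x u - of_real (u_crit\<^sup>2 / L\<^sup>2) = of_real ((u_crit - u) * (u_crit / L\<^sup>2)) * (\<xi>\<^sup>2 - 2)
        + of_real ((u_crit - u)\<^sup>2) * ((1 - \<xi>\<^sup>2) / of_real (L\<^sup>2))"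
      using x_err[of u] u by (simp only: algebra_simps)
    then show "(\<xi>\<^sup>2 - 2) + of_real (u_crit - u) * ((1 - \<xi>\<^sup>2) / of_real u_crit)
        = (?x u - of_real (u_crit\<^sup>2 / L\<^sup>2)) / of_real ((u_crit - u) * (u_crit / L\<^sup>2))"
      using ring[of "of_real (u_crit - u)" "of_real u_crit" "of_real (L\<^sup>2)"] u assms
      by (simp only: of_real_mult of_real_divide of_real_power of_real_eq_0_iff) auto
  qed

  have c_nz: "of_real ?c \<noteq> (0 :: complex)"
    using u_crit_sq_gt_4 u_crit_pos assms by (subst of_real_eq_0_iff) auto
  \<comment> \<open>An s^4 bound is enough here: after division by s^3 a factor s remains and tends
    to 0.\<close>
  have "(\<lambda>u. ?y u - ?ymain u) \<in> O[?F](\<lambda>u. local_param u ^ 4)"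
    using y_err bigo_local_param_mono[of 4 5] by (rule landau_o.big_trans) simp
  then obtain C where C: "eventually (\<lambda>u. norm (?y u - ?ymain u) \<le> C * norm (local_param u ^ 4)) ?F"
    by (rule landau_o.bigE)
  have "((\<lambda>u. C * norm (local_param u)) \<longlongrightarrow> C * norm (0 :: complex)) ?F"
    by (intro tendsto_intros local_param_tendsto_0)
  then have "((\<lambda>u. C * norm (local_param u)) \<longlongrightarrow> 0) ?F" by simp
  then have "((\<lambda>u. (?y u - ?ymain u) / local_param u ^ 3) \<longlongrightarrow> 0) ?F"
  proof (rule Lim_null_comparison[rotated], use C eventually_near_u_crit in eventually_elim)
    case (elim u)
    have "norm (w / s ^ 3) \<le> C * norm s" if "norm w \<le> C * norm (s ^ 4)" "s \<noteq> 0" for w s :: complex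
      using that by (simp add: norm_divide norm_power pos_divide_le_eq mult.assoc flip: power_Suc)
    from this[OF elim(1) local_param_nz] elim(2) show ?case by blast
  qed
  then have "((\<lambda>u. (\<xi> ^ 3 - 3 * \<xi>) + (?y u - ?ymain u) / local_param u ^ 3 / of_real ?c)
      \<longlongrightarrow> (\<xi> ^ 3 - 3 * \<xi>) + 0 / of_real ?c) ?F"
    by (intro tendsto_intros c_nz)
  then have "((\<lambda>u. (\<xi> ^ 3 - 3 * \<xi>) + (?y u - ?ymain u) / local_param u ^ 3 / of_real ?c)
      \<longlongrightarrow> minimal_y_32 \<xi>) ?F"
    by (simp add: minimal_y_32_def)
  then show "((\<lambda>u. ?y u / of_real ((u_crit - u) powr (3 / 2) * ?c)) \<longlongrightarrow> minimal_y_32 \<xi>) ?F"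
  proof (rule Lim_transform_eventually, use eventually_near_u_crit in eventually_elim)
    fix u assume u: "0 < u \<and> u < u_crit"
    have ring: "w + (y - s * c * w) / s / c = y / (s * c)" if "s \<noteq> 0" "c \<noteq> 0" for w y s c :: complex
      using that by (simp add: field_simps)
    have "local_param u ^ 3 \<noteq> 0" using u by (simp add: local_param_nz)
    from ring[OF this c_nz] show "(\<xi> ^ 3 - 3 * \<xi>) + (?y u - ?ymain u) / local_param u ^ 3 / of_real ?c
        = ?y u / of_real ((u_crit - u) powr (3 / 2) * ?c)"
      using u by (simp only: of_real_mult powr)
  qed
qed

end
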